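(* Let $\phi\in[0,1]$ be fixed, let $B_0\in\mathbb{R}^{n\times n}$ be symmetric positive definite, let $(s_0,y_0),\dots,(s_k,y_k)$ be pairs of vectors in $\mathbb{R}^n$, and let $B_1,\dots,B_{k+1}$ be obtained from $B_0$ by successive Broyden class updates with parameter $\phi$, all updates being well defined and all $B_i$ positive definite; put $H_i=B_i^{-1}$. Suppose that for all $j\in\{0,\dots,k\}$ $$H_{j+1}=H_0+\tilde\Psi_j\tilde M_j\tilde\Psi_j^T,$$ where $\tilde\Psi_j=\begin{bmatrix}S_j & H_0Y_j\end{bmatrix}$ and $$\tilde M_j=\begin{bmatrix}-\phi\Lambda_j & -R_j-D_j-\phi\Lambda_j\\ -R_j^T-D_j-\phi\Lambda_j & -D_j-\phi\Lambda_j-Y_j^TH_0Y_j\end{bmatrix}^{-1}.$$ For $0\le j\le k$ let $$\tilde\alpha_j=\frac{1}{s_j^Ty_j}+\Phi_j\frac{y_j^TH_jy_j}{(s_j^Ty_j)^2},\qquad \tilde\beta_j=-\frac{\Phi_j}{y_j^Ts_j},\qquad \tilde\delta_j=-\frac{1-\Phi_j}{y_j^TH_jy_j}.$$ If $\tilde M_0$ is given by $\tilde M_0=\begin{bmatrix}\tilde\alpha_0&\tilde\beta_0\\ \tilde\beta_0&\tilde\delta_0\end{bmatrix}$, then for all $j\in\{1,\dots,k\}$ the matrix $\tilde M_j$ satisfies the recursion $$\tilde M_j=\Pi_j^T\begin{bmatrix}\tilde M_{j-1}+\tilde\delta_j\tilde u_j\tilde u_j^T & \tilde\beta_j\tilde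 u_j & \tilde\delta_j\tilde u_j\\ \tilde\beta_j\tilde u_j^T&\tilde\alpha_j&\tilde\beta_j\\ \tilde\delta_j\tilde u_j^T&\tilde\beta_j&\tilde\delta_j\end{bmatrix}\Pi_j,$$ where $\tilde u_j=\tilde M_{j-1}\tilde\Psi_{j-1}^Ty_j$ and $$\Pi_j=\begin{bmatrix}I_j&0&0&0\\0&0&I_j&0\\0&1&0&0\\0&0&0&1\end{bmatrix}$$ (block rows of sizes $j,j,1,1$ and block columns of sizes $j,1,j,1$) is the permutation matrix such that $\begin{bmatrix}\tilde\Psi_{j-1}&s_j&H_0y_j\end{bmatrix}\Pi_j=\tilde\Psi_j$.
   Context: Broyden class update with parameter $\phi$: for $0\le i\le k$, $$B_{i+1}=B_i-\frac{1}{s_i^TB_is_i}B_is_is_i^TB_i+\frac{1}{y_i^Ts_i}y_iy_i^T+\phi(s_i^TB_is_i)w_iw_i^T,\qquad w_i=\frac{y_i}{y_i^Ts_i}-\frac{B_is_i}{s_i^TB_is_i}.$$ "All updates well defined" means $s_i\neq0$ and $y_i^Ts_i\neq0$ for $0\le i\le k$; positive definiteness means that $B_0,\dots,B_{k+1}$ are symmetric positive definite. Notation, for $0\le j\le k$: $S_j=[s_0\ \cdots\ s_j]$ and $Y_j=[y_0\ \cdots\ y_j]$, both in $\mathbb{R}^{n\times(j+1)}$; $S_j^TY_j=L_j+D_j+R_j$ with $L_j$ strictly lower triangular, $D_j$ diagonal, $R_j$ strictly upper triangular; $\Lambda_j=\mathrm{diag}(\lambda_0,\dots,\lambda_j)$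 with $$\lambda_i=\frac{1}{-\dfrac{1-\phi}{s_i^TB_is_i}-\dfrac{\phi}{s_i^Ty_i}};$$ and $$\Phi_j=\frac{(1-\phi)(y_j^Ts_j)^2}{(1-\phi)(y_j^Ts_j)^2+\phi(y_j^TH_jy_j)(s_j^TB_js_j)}.$$ $I_j$ denotes the $j\times j$ identity matrix. *)

theory Defs
  imports
    Complex_Main
    "HOL-Combinatorics.Permutations"
    "Jordan_Normal_Form.Matrix"
begin

definition sym_pos_def :: "nat \<Rightarrow> real mat \<Rightarrow> bool" where
  "sym_pos_def n A \<longleftrightarrow> A \<in> carrier_mat n n \<and> A\<^sup>T = A \<and>
     (\<forall>x \<in> carrier_vec n. x \<noteq> 0\<^sub>v n \<longrightarrow> x \<bullet> (A *\<^sub>v x) > 0)"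

text \<open>For a square \<open>A\<close>, the two equations also force \<open>B\<close> to be square of the same size.\<close>

definition is_inverse_mat :: "real mat \<Rightarrow> real mat \<Rightarrow> bool" where
  "is_inverse_mat A B \<longleftrightarrow> inverts_mat A B \<and> inverts_mat B A"

definition is_permutation_mat :: "nat \<Rightarrow> real mat \<Rightarrow> bool" where
  "is_permutation_mat m P \<longleftrightarrow>
     (\<exists>p. p permutes {..<m} \<and> P = mat m m (\<lambda>(a, b). if a = p b then 1 else 0))"

definition outer_prod :: "real vec \<Rightarrow> real vec \<Rightarrow> real mat" where
  "outer_prod u v = mat_of_cols (dim_vec u) [u] * mat_of_rows (dim_vec v) [v]"

definition append_cols :: "real mat \<Rightarrow> real mat \<Rightarrow> real mat" where
  "append_cols A B = mat_of_cols (dim_row A) (cols A @ cols B)"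

definition strict_lower_part :: "real mat \<Rightarrow> real mat" where
  "strict_lower_part A =
     mat (dim_row A) (dim_col A) (\<lambda>(a, b). if b < a then A $$ (a, b) else 0)"

definition diag_part :: "real mat \<Rightarrow> real mat" where
  "diag_part A =
     mat (dim_row A) (dim_col A) (\<lambda>(a, b). if a = b then A $$ (a, b) else 0)"

definition strict_upper_part :: "real mat \<Rightarrow> real mat" where
  "strict_upper_part A =
     mat (dim_row A) (dim_col A) (\<lambda>(a, b). if a < b then A $$ (a, b) else 0)"

lemma strict_lower_diag_strict_upper:
  "A = strict_lower_part A + diag_part A + strict_upper_part A"
  by (rule eq_matI) (auto simp: strict_lower_part_def diag_part_def strict_upper_part_def)

definition broyden_w :: "real mat \<Rightarrow> real vec \<Rightarrow> real vec \<Rightarrow> real vec" where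
  "broyden_w B s y =
     (1 / (y \<bullet> s)) \<cdot>\<^sub>v y - (1 / (s \<bullet> (B *\<^sub>v s))) \<cdot>\<^sub>v (B *\<^sub>v s)"

definition broyden_update :: "real \<Rightarrow> real mat \<Rightarrow> real vec \<Rightarrow> real vec \<Rightarrow> real mat" where
  "broyden_update \<phi> B s y =
     B - (1 / (s \<bullet> (B *\<^sub>v s))) \<cdot>\<^sub>m (B * outer_prod s s * B)
       + (1 / (y \<bullet> s)) \<cdot>\<^sub>m outer_prod y y
       + (\<phi> * (s \<bullet> (B *\<^sub>v s))) \<cdot>\<^sub>m outer_prod (broyden_w B s y) (broyden_w B s y)"

definition lambda_coeff :: "real \<Rightarrow> real mat \<Rightarrow> real vec \<Rightarrow> real vec \<Rightarrow> real" where
  "lambda_coeff \<phi> B s y = 1 / (- ((1 - \<phi>) / (s \<bullet> (B *\<^sub>v s))) - \<phi> / (s \<bullet> y))"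

definition Phi_coeff ::
  "real \<Rightarrow> real mat \<Rightarrow> real mat \<Rightarrow> real vec \<Rightarrow> real vec \<Rightarrow> real" where
  "Phi_coeff \<phi> B H s y =
     (1 - \<phi>) * (y \<bullet> s)\<^sup>2 /
     ((1 - \<phi>) * (y \<bullet> s)\<^sup>2 + \<phi> * (y \<bullet> (H *\<^sub>v y)) * (s \<bullet> (B *\<^sub>v s)))"

definition alpha_coeff ::
  "real \<Rightarrow> real mat \<Rightarrow> real mat \<Rightarrow> real vec \<Rightarrow> real vec \<Rightarrow> real" where
  "alpha_coeff \<phi> B H s y =
     1 / (s \<bullet> y) + Phi_coeff \<phi> B H s y * ((y \<bullet> (H *\<^sub>v y)) / (s \<bullet> y)\<^sup>2)"

definition beta_coeff ::
  "real \<Rightarrow> real mat \<Rightarrow> real mat \<Rightarrow> real vec \<Rightarrow> real vec \<Rightarrow> real" where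
  "beta_coeff \<phi> B H s y = - (Phi_coeff \<phi> B H s y / (y \<bullet> s))"

definition delta_coeff ::
  "real \<Rightarrow> real mat \<Rightarrow> real mat \<Rightarrow> real vec \<Rightarrow> real vec \<Rightarrow> real" where
  "delta_coeff \<phi> B H s y = - ((1 - Phi_coeff \<phi> B H s y) / (y \<bullet> (H *\<^sub>v y)))"

text \<open>\<open>cols_upto n v j\<close> is the \<open>n \<times> (j + 1)\<close> matrix with columns \<open>v 0, \<dots>, v j\<close>.\<close>

definition cols_upto :: "nat \<Rightarrow> (nat \<Rightarrow> real vec) \<Rightarrow> nat \<Rightarrow> real mat" where
  "cols_upto n v j = mat_of_cols n (map v [0..<Suc j])"

definition Psi_mat ::
  "nat \<Rightarrow> real mat \<Rightarrow> (nat \<Rightarrow> real vec) \<Rightarrow> (nat \<Rightarrow> real vec) \<Rightarrow> nat \<Rightarrow> real mat" where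
  "Psi_mat n H0 s y j = append_cols (cols_upto n s j) (H0 * cols_upto n y j)"

definition Lambda_mat ::
  "real \<Rightarrow> (nat \<Rightarrow> real mat) \<Rightarrow> (nat \<Rightarrow> real vec) \<Rightarrow> (nat \<Rightarrow> real vec) \<Rightarrow> nat \<Rightarrow> real mat" where
  "Lambda_mat \<phi> B s y j = mat_diag (Suc j) (\<lambda>i. lambda_coeff \<phi> (B i) (s i) (y i))"

text \<open>The matrix whose inverse is the middle factor of the compact representation of
  \<open>H (j + 1)\<close>.\<close>

definition middle_mat ::
  "nat \<Rightarrow> real \<Rightarrow> (nat \<Rightarrow> real mat) \<Rightarrow> real mat \<Rightarrow> (nat \<Rightarrow> real vec) \<Rightarrow> (nat \<Rightarrow> real vec) \<Rightarrow>
     nat \<Rightarrow> real mat" where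
  "middle_mat n \<phi> B H0 s y j =
     (let S = cols_upto n s j; Y = cols_upto n y j;
          D = diag_part (S\<^sup>T * Y); R = strict_upper_part (S\<^sup>T * Y);
          \<Lambda> = Lambda_mat \<phi> B s y j
      in four_block_mat
           (- (\<phi> \<cdot>\<^sub>m \<Lambda>))         (- R - D - \<phi> \<cdot>\<^sub>m \<Lambda>)
           (- (R\<^sup>T) - D - \<phi> \<cdot>\<^sub>m \<Lambda>) (- D - \<phi> \<cdot>\<^sub>m \<Lambda> - Y\<^sup>T * H0 * Y))"

text \<open>Block rows of sizes \<open>j, j, 1, 1\<close> and block columns of sizes \<open>j, 1, j, 1\<close>, assembled from
  a \<open>2 \<times> 2\<close> arrangement of \<open>2 \<times> 2\<close> blocks.\<close>

definition Pi_mat :: "nat \<Rightarrow> real mat" where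
  "Pi_mat j = four_block_mat
     (four_block_mat (1\<^sub>m j)   (0\<^sub>m j 1)
                     (0\<^sub>m j j) (0\<^sub>m j 1))
     (four_block_mat (0\<^sub>m j j) (0\<^sub>m j 1)
                     (1\<^sub>m j)   (0\<^sub>m j 1))
     (four_block_mat (0\<^sub>m 1 j) (1\<^sub>m 1)
                     (0\<^sub>m 1 j) (0\<^sub>m 1 1))
     (four_block_mat (0\<^sub>m 1 j) (0\<^sub>m 1 1)
                     (0\<^sub>m 1 j) (1\<^sub>m 1))"

text \<open>The \<open>3 \<times> 3\<close> block matrix with rows \<open>M + \<delta> u u\<^sup>T, \<beta> u, \<delta> u\<close>, then \<open>\<beta> u\<^sup>T, \<alpha>, \<beta>\<close>, then
  \<open>\<delta> u\<^sup>T, \<beta>, \<delta>\<close>; the last two block rows and block columns have size one.\<close>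

definition bordered_mat :: "real mat \<Rightarrow> real vec \<Rightarrow> real \<Rightarrow> real \<Rightarrow> real \<Rightarrow> real mat" where
  "bordered_mat M u \<alpha> \<beta> \<delta> = four_block_mat
     (M + \<delta> \<cdot>\<^sub>m outer_prod u u)
     (mat_of_cols (dim_vec u) [\<beta> \<cdot>\<^sub>v u, \<delta> \<cdot>\<^sub>v u])
     (mat_of_rows (dim_vec u) [\<beta> \<cdot>\<^sub>v u, \<delta> \<cdot>\<^sub>v u])
     (mat_of_rows_list 2 [[\<alpha>, \<beta>], [\<beta>, \<delta>]])"

end

theory Submission
  imports Defs "Jordan_Normal_Form.Determinant"
begin

text \<open>Write \<open>N\<^sub>j\<close> for \<open>middle_mat\<close>, so that \<open>M\<^sub>j\<close> is the inverse of \<open>N\<^sub>j\<close>, and let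
  \<open>p = \<Psi>\<^sub>j\<^sub>-\<^sub>1\<^sup>T y\<^sub>j\<close>. The recursion is block inversion, read backwards. An entry of \<open>N\<^sub>j\<close> depends only
  on the two pairs to which its row and column belong, and on whether these stand for an \<open>s\<close> or
  for a \<open>y\<close>, but not on \<open>j\<close>. So if \<open>s\<^sub>j\<close> and \<open>y\<^sub>j\<close> are moved to the end, \<open>N\<^sub>j\<close> becomes
  \<open>N\<^sub>j\<^sub>-\<^sub>1\<close> bordered by two rows and columns, and by triangularity of \<open>R\<close> the border consists of
  \<open>0\<close> (for \<open>s\<^sub>j\<close>) and \<open>- p\<close> (for \<open>y\<^sub>j\<close>), with a \<open>2 \<times> 2\<close> corner
  \<open>[[a, b], [b, c]]\<close> (\<open>middle_mat_permute\<close>). The moving is conjugation by the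
  permutation matrix \<open>\<Pi>\<^sub>j\<close>.

  With \<open>u = M\<^sub>j\<^sub>-\<^sub>1 p\<close> the Schur complement of \<open>N\<^sub>j\<^sub>-\<^sub>1\<close> in the bordered matrix is
  \<open>[[a, b], [b, c - p \<bullet> u]]\<close>. If its inverse is \<open>[[\<alpha>, \<beta>], [\<beta>, \<delta>]]\<close>, then
  multiplying out shows that the matrix of the recursion inverts the bordered matrix
  (\<open>four_block_inverse_bordered\<close>).

  It remains to identify the Schur complement. The compact representation of \<open>H\<^sub>j\<close> gives
  \<open>y\<^sub>j \<bullet> H\<^sub>j y\<^sub>j = y\<^sub>j \<bullet> H\<^sub>0 y\<^sub>j + p \<bullet> u\<close>, so \<open>H\<^sub>0\<close> and all earlier pairs disappear from
  \<open>c - p \<bullet> u\<close>, and the claim becomes an identity between rational functions of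
  \<open>\<sigma> = s\<^sub>j \<bullet> y\<^sub>j\<close>, \<open>\<tau> = s\<^sub>j \<bullet> B\<^sub>j s\<^sub>j\<close>, \<open>\<eta> = y\<^sub>j \<bullet> H\<^sub>j y\<^sub>j\<close> and \<open>\<phi>\<close> (\<open>corner_inverse\<close>).
  Its denominators are \<open>(1 - \<phi>) \<sigma> + \<phi> \<tau>\<close> and \<open>(1 - \<phi>) \<sigma>\<^sup>2 + \<phi> \<eta> \<tau>\<close>. The first could vanish
  for negative \<open>\<sigma>\<close>; but the update satisfies the secant equation \<open>B\<^sub>j\<^sub>+\<^sub>1 s\<^sub>j = y\<^sub>j\<close>
  (\<open>broyden_update_secant\<close>), whence \<open>\<sigma> = s\<^sub>j \<bullet> B\<^sub>j\<^sub>+\<^sub>1 s\<^sub>j > 0\<close> by positive definiteness.\<close>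

section \<open>Matrix and vector products\<close>

lemma index_outer_prod [simp]:
  "i < dim_vec u \<Longrightarrow> j < dim_vec v \<Longrightarrow> outer_prod u v $$ (i, j) = u $ i * v $ j"
  "dim_row (outer_prod u v) = dim_vec u"
  "dim_col (outer_prod u v) = dim_vec v"
  by (auto simp: outer_prod_def scalar_prod_def mat_of_cols_def mat_of_rows_def)

lemma outer_prod_mult_vec:
  assumes "v \<in> carrier_vec n" "x \<in> carrier_vec n"
  shows "outer_prod u v *\<^sub>v x = (v \<bullet> x) \<cdot>\<^sub>v u"
  using assms by (intro eq_vecI) (auto simp: scalar_prod_def sum_distrib_left mult_ac)

lemma smult_mat_mult_vec:
  fixes A :: "real mat"
  assumes "A \<in> carrier_mat n m" "x \<in> carrier_vec m"
  shows "(r \<cdot>\<^sub>m A) *\<^sub>v x = r \<cdot>\<^sub>v (A *\<^sub>v x)"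
  using assms by (intro eq_vecI) (auto simp: scalar_prod_def sum_distrib_left mult.assoc)

lemma scalar_prod_mult_mat_vec:
  fixes A :: "real mat"
  assumes "A \<in> carrier_mat n m" "v \<in> carrier_vec n" "w \<in> carrier_vec m"
  shows "v \<bullet> (A *\<^sub>v w) = (A\<^sup>T *\<^sub>v v) \<bullet> w"
  using transpose_vec_mult_scalar[OF assms(1,3,2)] assms
  by (metis comm_scalar_prod mult_mat_vec_carrier transpose_carrier_mat)

lemma outer_prod_mult:
  assumes "v \<in> carrier_vec m" "A \<in> carrier_mat m r"
  shows "outer_prod u v * A = outer_prod u (A\<^sup>T *\<^sub>v v)"
  using assms
  by (intro eq_matI) (auto simp: scalar_prod_def sum_distrib_left mult_ac)

text \<open>Products of matrices that are given by two columns, two rows or four entries. They reduce the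
  block computation below to operations on the two border vectors.\<close>

lemma mult_mat_of_cols_pair:
  fixes A :: "real mat"
  assumes "A \<in> carrier_mat r m" "v \<in> carrier_vec m" "w \<in> carrier_vec m"
  shows "A * mat_of_cols m [v, w] = mat_of_cols r [A *\<^sub>v v, A *\<^sub>v w]"
  using assms by (intro eq_matI) (auto simp: less_2_cases_iff less_Suc_eq mat_of_cols_index)

lemma mat_of_rows_pair_mult:
  fixes A :: "real mat"
  assumes "A \<in> carrier_mat m r" "v \<in> carrier_vec m" "w \<in> carrier_vec m"
  shows "mat_of_rows m [v, w] * A = mat_of_rows r [A\<^sup>T *\<^sub>v v, A\<^sup>T *\<^sub>v w]"
  using assms comm_scalar_prod[of v m] comm_scalar_prod[of w m]
  by (intro eq_matI) (auto simp: less_2_cases_iff less_Suc_eq mat_of_rows_index)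

lemma mat_of_cols_pair_mult_mat_of_rows_pair:
  assumes "v \<in> carrier_vec m" "w \<in> carrier_vec m" "x \<in> carrier_vec r" "z \<in> carrier_vec r"
  shows "mat_of_cols m [v, w] * mat_of_rows r [x, z] = outer_prod v x + outer_prod w z"
  using assms
  by (intro eq_matI) (auto simp: scalar_prod_def mat_of_cols_index mat_of_rows_index)

lemma mat_of_rows_pair_mult_mat_of_cols_pair:
  assumes "v \<in> carrier_vec m" "w \<in> carrier_vec m" "x \<in> carrier_vec m" "z \<in> carrier_vec m"
  shows "mat_of_rows m [v, w] * mat_of_cols m [x, z]
    = mat_of_rows_list 2 [[v \<bullet> x, v \<bullet> z], [w \<bullet> x, w \<bullet> z]]"
  using assms by (intro eq_matI) (auto simp: less_2_cases_iff less_Suc_eq mat_of_rows_list_def)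

lemma mat_of_cols_pair_mult_rows_list:
  fixes a :: real
  assumes "v \<in> carrier_vec m" "w \<in> carrier_vec m"
  shows "mat_of_cols m [v, w] * mat_of_rows_list 2 [[a, b], [c, d]]
    = mat_of_cols m [a \<cdot>\<^sub>v v + c \<cdot>\<^sub>v w, b \<cdot>\<^sub>v v + d \<cdot>\<^sub>v w]"
  using assms
  by (intro eq_matI)
    (auto simp: less_2_cases_iff less_Suc_eq mat_of_rows_list_def scalar_prod_def mat_of_cols_index mult.commute)

lemma rows_list_mult_mat_of_rows_pair:
  assumes "v \<in> carrier_vec m" "w \<in> carrier_vec m"
  shows "mat_of_rows_list 2 [[a, b], [c, d]] * mat_of_rows m [v, w]
    = mat_of_rows m [a \<cdot>\<^sub>v v + b \<cdot>\<^sub>v w, c \<cdot>\<^sub>v v + d \<cdot>\<^sub>v w]"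
  using assms
  by (intro eq_matI)
    (auto simp: less_2_cases_iff less_Suc_eq mat_of_rows_list_def scalar_prod_def mat_of_rows_index)

lemma rows_list_mult_rows_list:
  fixes a :: real
  shows "mat_of_rows_list 2 [[a, b], [c, d]] * mat_of_rows_list 2 [[a', b'], [c', d']]
    = mat_of_rows_list 2 [[a * a' + b * c', a * b' + b * d'], [c * a' + d * c', c * b' + d * d']]"
  by (intro eq_matI) (auto simp: less_2_cases_iff less_Suc_eq mat_of_rows_list_def scalar_prod_def)

section \<open>Inverses of symmetric matrices\<close>

lemma is_inverse_mat_carrier:
  assumes "is_inverse_mat A B" "A \<in> carrier_mat m m"
  shows "B \<in> carrier_mat m m" "A * B = 1\<^sub>m m" "B * A = 1\<^sub>m m"
proof -
  have 1: "A * B = 1\<^sub>m m" "B * A = 1\<^sub>m (dim_row B)"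
    using assms by (auto simp: is_inverse_mat_def inverts_mat_def)
  have "dim_col B = m" using arg_cong[OF 1(1), of dim_col] by simp
  moreover have "dim_row B = m" using arg_cong[OF 1(2), of dim_col] assms(2) by simp
  ultimately show "B \<in> carrier_mat m m" by auto
  show "A * B = 1\<^sub>m m" "B * A = 1\<^sub>m m" using 1 \<open>dim_row B = m\<close> by auto
qed

lemma transpose_inverse_symmetric:
  fixes A B :: "real mat"
  assumes "is_inverse_mat A B" "A \<in> carrier_mat m m" "A\<^sup>T = A"
  shows "B\<^sup>T = B"
proof -
  note B = is_inverse_mat_carrier[OF assms(1,2)]
  have "B\<^sup>T * A = 1\<^sub>m m"
    using B transpose_mult[OF assms(2) B(1)] assms(3) by simp
  then have "B\<^sup>T * A * B = B" using B(1) by simp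
  moreover have "B\<^sup>T * A * B = B\<^sup>T * (A * B)"
    using B assms(2) by (intro assoc_mult_mat) auto
  ultimately show ?thesis using B by simp
qed

text \<open>Substituting \<open>y = B (H y)\<close> turns the quadratic form of the inverse \<open>H\<close> at \<open>y\<close> into that of \<open>B\<close>
  at \<open>H y\<close>.\<close>
lemma sym_pos_def_inverse_quadratic_form_pos:
  assumes "sym_pos_def n B" "is_inverse_mat B H" "y \<in> carrier_vec n" "y \<noteq> 0\<^sub>v n"
  shows "y \<bullet> (H *\<^sub>v y) > 0"
proof -
  have B: "B \<in> carrier_mat n n" using assms(1) by (simp add: sym_pos_def_def)
  note H = is_inverse_mat_carrier[OF assms(2) B]
  have Hy: "H *\<^sub>v y \<in> carrier_vec n" using H assms(3) by auto
  have BHy: "B *\<^sub>v (H *\<^sub>v y) = y"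
    using assoc_mult_mat_vec[OF B H(1) assms(3)] H assms(3) by simp
  have "H *\<^sub>v y \<noteq> 0\<^sub>v n"
  proof
    assume "H *\<^sub>v y = 0\<^sub>v n"
    then have "y = B *\<^sub>v 0\<^sub>v n" using BHy by simp
    also have "\<dots> = 0\<^sub>v n" using B by (intro eq_vecI) auto
    finally show False using assms(4) by simp
  qed
  then have "(H *\<^sub>v y) \<bullet> (B *\<^sub>v (H *\<^sub>v y)) > 0"
    using assms(1) Hy by (auto simp: sym_pos_def_def)
  then show ?thesis using comm_scalar_prod[OF Hy assms(3)] by (simp add: BHy)
qed

section \<open>The secant equation\<close>

text \<open>Every member of the Broyden class satisfies the secant equation, because \<open>w \<bullet> s = 0\<close> removes the
  term with \<open>\<phi>\<close>, the first two terms cancel when applied to \<open>s\<close>, and the third gives \<open>y\<close>.\<close>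
lemma broyden_update_secant:
  assumes B: "B \<in> carrier_mat n n" and s: "s \<in> carrier_vec n" and y: "y \<in> carrier_vec n"
    and "s \<bullet> (B *\<^sub>v s) \<noteq> 0" "y \<bullet> s \<noteq> 0"
  shows "broyden_update \<phi> B s y *\<^sub>v s = y"
proof -
  define \<tau> where "\<tau> = s \<bullet> (B *\<^sub>v s)"
  define w where "w = broyden_w B s y"
  have Bs: "B *\<^sub>v s \<in> carrier_vec n" using B s by simp
  have w: "w \<in> carrier_vec n" using y Bs by (simp add: w_def broyden_w_def)
  have "w \<bullet> s = 0"
    using s y Bs assms(4,5) comm_scalar_prod[OF s Bs]
    by (simp add: w_def broyden_w_def minus_scalar_prod_distrib[of _ n])
  have O: "outer_prod s s \<in> carrier_mat n n" "outer_prod y y \<in> carrier_mat n n"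
    "outer_prod w w \<in> carrier_mat n n"
    using s y w by (auto intro!: carrier_matI)
  have "(B * outer_prod s s * B) *\<^sub>v s = B *\<^sub>v (outer_prod s s *\<^sub>v (B *\<^sub>v s))"
    using B O s Bs assoc_mult_mat_vec[of "B * outer_prod s s" n n B n s]
      assoc_mult_mat_vec[OF B O(1) Bs] by simp
  also have "\<dots> = \<tau> \<cdot>\<^sub>v (B *\<^sub>v s)"
    using outer_prod_mult_vec[OF s Bs] B s by (simp add: \<tau>_def mult_mat_vec[of B n n])
  finally have 1: "(B * outer_prod s s * B) *\<^sub>v s = \<tau> \<cdot>\<^sub>v (B *\<^sub>v s)" .
  define Q where "Q = B * outer_prod s s * B"
  have Q: "Q \<in> carrier_mat n n" using B O by (auto simp: Q_def)
  have "broyden_update \<phi> B s y *\<^sub>v s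
      = B *\<^sub>v s - (1 / \<tau>) \<cdot>\<^sub>v (Q *\<^sub>v s)
        + (1 / (y \<bullet> s)) \<cdot>\<^sub>v (outer_prod y y *\<^sub>v s) + (\<phi> * \<tau>) \<cdot>\<^sub>v (outer_prod w w *\<^sub>v s)"
  proof -
    let ?X = "(1 / \<tau>) \<cdot>\<^sub>m Q" and ?Y = "(1 / (y \<bullet> s)) \<cdot>\<^sub>m outer_prod y y"
      and ?Z = "(\<phi> * \<tau>) \<cdot>\<^sub>m outer_prod w w"
    have X: "?X \<in> carrier_mat n n" and Y: "?Y \<in> carrier_mat n n" and Z: "?Z \<in> carrier_mat n n"
      using Q O by auto
    have "(B - ?X + ?Y + ?Z) *\<^sub>v s = B *\<^sub>v s - ?X *\<^sub>v s + ?Y *\<^sub>v s + ?Z *\<^sub>v s"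
      using add_mult_distrib_mat_vec[of "B - ?X + ?Y" n n ?Z s]
        add_mult_distrib_mat_vec[of "B - ?X" n n ?Y s] minus_mult_distrib_mat_vec[OF B X s]
        B X Y Z s by (simp add: minus_carrier_mat)
    then show ?thesis
      unfolding broyden_update_def w_def[symmetric] \<tau>_def[symmetric] Q_def[symmetric]
      using smult_mat_mult_vec[OF Q s] smult_mat_mult_vec[OF O(2) s] smult_mat_mult_vec[OF O(3) s]
      by simp
  qed
  also have "\<dots> = y"
    using outer_prod_mult_vec[OF y s] outer_prod_mult_vec[OF w s] \<open>w \<bullet> s = 0\<close> assms(4,5) B Bs y w
    by (intro eq_vecI) (auto simp: 1[folded Q_def] \<tau>_def[symmetric])
  finally show ?thesis .
qed

section \<open>The Schur complement of a new pair\<close>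

text \<open>The \<open>2 \<times> 2\<close> matrix \<open>[[a, b], [b, c]]\<close> is the Schur complement that a new pair contributes,
  with \<open>\<sigma> = s \<bullet> y\<close>, \<open>\<tau> = s \<bullet> B s\<close>, \<open>\<eta> = y \<bullet> H y\<close>. Over the common denominators \<open>E\<close> and \<open>F\<close> of
  the proof, \<open>a = \<phi> \<sigma> \<tau> / E\<close>, \<open>b = - (1 - \<phi>) \<sigma>\<^sup>2 / E\<close>, \<open>c = b - \<eta>\<close>, while
  \<open>\<beta> = - (1 - \<phi>) \<sigma> / F\<close> and \<open>\<delta> = - \<phi> \<tau> / F\<close>; clearing \<open>l\<close> and \<open>\<Phi>\<close> in this way is the
  whole content of the lemma.\<close>
lemma corner_inverse:
  fixes \<sigma> \<tau> \<eta> \<phi> :: real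
  assumes "0 \<le> \<phi>" "\<phi> \<le> 1" "\<sigma> > 0" "\<tau> > 0" "\<eta> > 0"
  defines "l \<equiv> 1 / (- ((1 - \<phi>) / \<tau>) - \<phi> / \<sigma>)"
  defines "\<Phi> \<equiv> (1 - \<phi>) * \<sigma>\<^sup>2 / ((1 - \<phi>) * \<sigma>\<^sup>2 + \<phi> * \<eta> * \<tau>)"
  defines "\<alpha> \<equiv> 1 / \<sigma> + \<Phi> * (\<eta> / \<sigma>\<^sup>2)" and "\<beta> \<equiv> - (\<Phi> / \<sigma>)" and "\<delta> \<equiv> - ((1 - \<Phi>) / \<eta>)"
  defines "a \<equiv> - (\<phi> * l)" and "b \<equiv> - \<sigma> - \<phi> * l" and "c \<equiv> - \<sigma> - \<phi> * l - \<eta>"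
  shows "\<alpha> * a + \<beta> * b = 1" "\<alpha> * b + \<beta> * c = 0" "\<beta> * a + \<delta> * b = 0" "\<beta> * b + \<delta> * c = 1"
proof -
  define E where "E = (1 - \<phi>) * \<sigma> + \<phi> * \<tau>"
  define F where "F = (1 - \<phi>) * \<sigma>\<^sup>2 + \<phi> * \<eta> * \<tau>"
  \<comment> \<open>A convex combination of positive numbers is positive: \<open>\<sigma>, \<tau>\<close> for \<open>E\<close>, and \<open>\<sigma>\<^sup>2, \<eta> \<tau>\<close> for \<open>F\<close>.\<close>
  have pos: "(1 - \<phi>) * p + \<phi> * q > 0" if "p > 0" "q > 0" for p q :: real
  proof (cases "\<phi> = 0")
    case False
    then have "\<phi> * q > 0" "(1 - \<phi>) * p \<ge> 0" using that assms by auto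
    then show ?thesis by linarith
  qed (use that in simp)
  have E: "E \<noteq> 0" using pos[of \<sigma> \<tau>] assms by (simp add: E_def)
  have F: "F \<noteq> 0" using pos[of "\<sigma>\<^sup>2" "\<eta> * \<tau>"] assms by (simp add: F_def mult.assoc)
  note nz = E F assms(3-5)
  have l: "l = - (\<sigma> * \<tau>) / E"
  proof -
    have "- ((1 - \<phi>) / \<tau>) - \<phi> / \<sigma> = - E / (\<sigma> * \<tau>)" using nz by (simp add: E_def field_simps)
    then show ?thesis by (simp add: l_def)
  qed
  have \<Phi>: "\<Phi> = (1 - \<phi>) * \<sigma>\<^sup>2 / F" by (simp add: \<Phi>_def F_def)
  have \<alpha>: "\<alpha> = 1 / \<sigma> + (1 - \<phi>) * \<eta> / F" using nz by (simp add: \<alpha>_def \<Phi> field_simps)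
  have \<beta>: "\<beta> = - ((1 - \<phi>) * \<sigma>) / F" using nz by (simp add: \<beta>_def \<Phi> field_simps power2_eq_square)
  have "1 - \<Phi> = \<phi> * \<eta> * \<tau> / F" using nz by (simp add: \<Phi> field_simps) (simp add: F_def algebra_simps)
  then have \<delta>: "\<delta> = - (\<phi> * \<tau>) / F" using nz by (simp add: \<delta>_def field_simps)
  have a: "a = \<phi> * \<sigma> * \<tau> / E" by (simp add: a_def l)
  have b: "b = - ((1 - \<phi>) * \<sigma>\<^sup>2) / E" using nz
    by (simp add: b_def l field_simps) (simp add: E_def power2_eq_square algebra_simps)
  have c: "c = b - \<eta>" by (simp add: b_def c_def)
  show 3: "\<beta> * a + \<delta> * b = 0" using nz by (simp add: \<beta> \<delta> a b field_simps power2_eq_square)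
  have "\<alpha> * a + \<beta> * b = \<phi> * \<tau> / E + (1 - \<phi>) * \<sigma> * (\<phi> * \<eta> * \<tau> + (1 - \<phi>) * \<sigma>\<^sup>2) / (E * F)"
    using nz by (simp add: \<alpha> \<beta> a b field_simps power2_eq_square)
  also have "\<dots> = (\<phi> * \<tau> + (1 - \<phi>) * \<sigma>) / E"
  proof -
    have "\<phi> * \<eta> * \<tau> + (1 - \<phi>) * \<sigma>\<^sup>2 = F" by (simp add: F_def)
    then show ?thesis using nz by (simp add: add_divide_distrib)
  qed
  finally show "\<alpha> * a + \<beta> * b = 1" using nz by (simp add: E_def add.commute)
  have "(\<alpha> + \<beta>) * b = \<beta> * \<eta>"
  proof -
    have "\<alpha> + \<beta> = (F + (1 - \<phi>) * \<sigma> * \<eta> - (1 - \<phi>) * \<sigma>\<^sup>2) / (\<sigma> * F)"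
      using nz by (simp add: \<alpha> \<beta> field_simps power2_eq_square)
    also have "F + (1 - \<phi>) * \<sigma> * \<eta> - (1 - \<phi>) * \<sigma>\<^sup>2 = \<eta> * E"
      by (simp add: F_def E_def algebra_simps)
    finally have "(\<alpha> + \<beta>) * b = \<eta> * E / (\<sigma> * F) * b" by (rule arg_cong)
    then show ?thesis using nz by (simp add: \<beta> b power2_eq_square)
  qed
  then show "\<alpha> * b + \<beta> * c = 0" by (simp add: c algebra_simps)
  have "(\<beta> + \<delta>) * b = (1 - \<phi>) * \<sigma>\<^sup>2 / F"
  proof -
    have "\<beta> + \<delta> = - E / F" using nz by (simp add: \<beta> \<delta> E_def field_simps)
    then show ?thesis using nz by (simp add: b)
  qed
  moreover have "\<delta> * \<eta> = - (\<phi> * \<eta> * \<tau>) / F" by (simp add: \<delta>)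
  ultimately have "(\<beta> + \<delta>) * b - \<delta> * \<eta> = ((1 - \<phi>) * \<sigma>\<^sup>2 + \<phi> * \<eta> * \<tau>) / F"
    by (simp add: add_divide_distrib)
  then have "(\<beta> + \<delta>) * b - \<delta> * \<eta> = 1" using nz by (simp add: F_def[symmetric])
  then show "\<beta> * b + \<delta> * c = 1" using nz by (simp add: c algebra_simps)
qed

section \<open>Inverting a bordered matrix\<close>

text \<open>Block inversion for a border of width two whose first border vector is \<open>0\<close> and whose second
  is \<open>- p\<close>. Since \<open>N u = p\<close> and \<open>N\<close> is symmetric, \<open>u\<^sup>T N = p\<^sup>T\<close>, so the rank-one correction
  \<open>\<delta> u u\<^sup>T\<close> produces \<open>\<delta> u p\<^sup>T\<close>, which the border cancels, and
  the lower left block vanishes for the same reason. The two right-hand blocks reduce to the four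
  scalar equations for the inverse of the Schur complement.\<close>
lemma four_block_inverse_bordered:
  fixes N M :: "real mat" and p :: "real vec" and a b c \<alpha> \<beta> \<delta> :: real
  assumes N: "N \<in> carrier_mat m m" "N\<^sup>T = N" and M: "M \<in> carrier_mat m m" "M * N = 1\<^sub>m m" "N * M = 1\<^sub>m m"
    and p: "p \<in> carrier_vec m"
  defines "u \<equiv> M *\<^sub>v p"
  defines "c' \<equiv> c - p \<bullet> u"
  assumes corner: "\<alpha> * a + \<beta> * b = 1" "\<alpha> * b + \<beta> * c' = 0"
      "\<beta> * a + \<delta> * b = 0" "\<beta> * b + \<delta> * c' = 1"
  shows "bordered_mat M u \<alpha> \<beta> \<delta> *
    four_block_mat N (mat_of_cols m [0\<^sub>v m, - p]) (mat_of_rows m [0\<^sub>v m, - p])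
      (mat_of_rows_list 2 [[a, b], [b, c]]) = 1\<^sub>m (m + 2)"
proof -
  have u: "u \<in> carrier_vec m" using M p by (simp add: u_def)
  have [simp]: "dim_vec u = m" "dim_vec p = m" using u p by auto
  have Nu: "N *\<^sub>v u = p"
    using assoc_mult_mat_vec[OF N(1) M(1) p] p by (simp add: u_def M(3))
  let ?U = "mat_of_cols m [\<beta> \<cdot>\<^sub>v u, \<delta> \<cdot>\<^sub>v u]" and ?V = "mat_of_rows m [\<beta> \<cdot>\<^sub>v u, \<delta> \<cdot>\<^sub>v u]"
  let ?P = "mat_of_cols m [0\<^sub>v m, - p]" and ?Q = "mat_of_rows m [0\<^sub>v m, - p]"
  let ?K = "mat_of_rows_list 2 [[\<alpha>, \<beta>], [\<beta>, \<delta>]]" and ?C = "mat_of_rows_list 2 [[a, b], [b, c]]"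
  let ?M = "M + \<delta> \<cdot>\<^sub>m outer_prod u u"
  have O: "outer_prod u u \<in> carrier_mat m m" by (auto intro!: carrier_matI)
  then have M': "?M \<in> carrier_mat m m" using M(1) by auto
  have NTu: "N\<^sup>T *\<^sub>v u = p" by (simp add: N(2) Nu)
  have up: "u \<bullet> p = p \<bullet> u" using u p by (rule comm_scalar_prod)
  have du: "r \<cdot>\<^sub>v u \<in> carrier_vec m" for r using u by simp
  have mp: "- p \<in> carrier_vec m" using p by simp
  have 1: "?M * N + ?U * ?Q = 1\<^sub>m m"
  proof -
    have "?M * N = M * N + \<delta> \<cdot>\<^sub>m (outer_prod u u * N)"
      using add_mult_distrib_mat[OF M(1) _ N(1), of "\<delta> \<cdot>\<^sub>m outer_prod u u"]
        mult_smult_assoc_mat[OF O N(1)] O by simp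
    also have "\<dots> = 1\<^sub>m m + \<delta> \<cdot>\<^sub>m outer_prod u p"
      by (simp add: M(2) outer_prod_mult[OF u N(1)] NTu)
    finally show ?thesis
      by (simp add: mat_of_cols_pair_mult_mat_of_rows_pair[OF du du zero_carrier_vec mp])
        (auto intro!: eq_matI)
  qed
  have 2: "?M * ?P + ?U * ?C = 0\<^sub>m m 2"
  proof -
    have "?M *\<^sub>v (- p) = - (1 + \<delta> * (p \<bullet> u)) \<cdot>\<^sub>v u"
    proof -
      have "?M *\<^sub>v (- p) = - (?M *\<^sub>v p)" using M' p by (intro eq_vecI) auto
      also have "?M *\<^sub>v p = u + \<delta> \<cdot>\<^sub>v ((u \<bullet> p) \<cdot>\<^sub>v u)"
        using add_mult_distrib_mat_vec[OF M(1) _ p, of "\<delta> \<cdot>\<^sub>m outer_prod u u"] O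
          smult_mat_mult_vec[OF O p] outer_prod_mult_vec[OF u p] by (simp add: u_def)
      finally show ?thesis using u by (auto intro!: eq_vecI simp: up algebra_simps)
    qed
    moreover have "?M *\<^sub>v 0\<^sub>v m = 0\<^sub>v m" using M' by (intro eq_vecI) auto
    ultimately have "?M * ?P = mat_of_cols m [0\<^sub>v m, - (1 + \<delta> * (p \<bullet> u)) \<cdot>\<^sub>v u]"
      using mult_mat_of_cols_pair[OF M' zero_carrier_vec mp] by simp
    moreover have "?U * ?C = mat_of_cols m [(\<beta> * a + \<delta> * b) \<cdot>\<^sub>v u, (\<beta> * b + \<delta> * c) \<cdot>\<^sub>v u]"
      unfolding mat_of_cols_pair_mult_rows_list[OF du du]
      by (intro arg_cong[of _ _ "mat_of_cols m"]) (auto intro!: eq_vecI simp: algebra_simps)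
    moreover have "\<beta> * b + \<delta> * c = 1 + \<delta> * (p \<bullet> u)"
      using corner(4) by (simp add: c'_def algebra_simps)
    ultimately show ?thesis using corner(3) u
      by (auto intro!: eq_matI simp: algebra_simps less_2_cases_iff less_Suc_eq mat_of_cols_index)
  qed
  have 3: "?V * N + ?K * ?Q = 0\<^sub>m 2 m"
  proof -
    have "N\<^sup>T *\<^sub>v (r \<cdot>\<^sub>v u) = r \<cdot>\<^sub>v p" for r
      using mult_mat_vec[of "N\<^sup>T" m m u r] N(1) u by (simp add: NTu)
    then show ?thesis
      unfolding mat_of_rows_pair_mult[OF N(1) du du]
        rows_list_mult_mat_of_rows_pair[OF zero_carrier_vec mp]
      by (auto intro!: eq_matI simp: less_2_cases_iff less_Suc_eq mat_of_rows_index)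
  qed
  have 4: "?V * ?P + ?K * ?C = 1\<^sub>m 2"
  proof -
    have "\<beta> * (u \<bullet> p) = \<alpha> * b + \<beta> * c" "\<delta> * (u \<bullet> p) = \<beta> * b + \<delta> * c - 1"
      using corner(2,4) by (auto simp: c'_def up algebra_simps)
    moreover have "?V * ?P = mat_of_rows_list 2 [[0, - (\<beta> * (u \<bullet> p))], [0, - (\<delta> * (u \<bullet> p))]]"
      unfolding mat_of_rows_pair_mult_mat_of_cols_pair[OF du du zero_carrier_vec mp]
      using u p by simp
    ultimately show ?thesis using corner(1,3) unfolding rows_list_mult_rows_list
      by (auto intro!: eq_matI simp: less_2_cases_iff less_Suc_eq mat_of_rows_list_def)
  qed
  have "bordered_mat M u \<alpha> \<beta> \<delta> * four_block_mat N ?P ?Q ?C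
      = four_block_mat (?M * N + ?U * ?Q) (?M * ?P + ?U * ?C) (?V * N + ?K * ?Q) (?V * ?P + ?K * ?C)"
    unfolding bordered_mat_def using N(1) M(1)
    by (subst mult_four_block_mat[of _ m m _ 2 _ 2])
      (auto simp: mat_of_rows_list_def numeral_2_eq_2 intro!: carrier_matI)
  then show ?thesis by (simp add: 1 2 3 4)
qed

section \<open>Conjugation by a permutation matrix\<close>

definition perm_mat :: "nat \<Rightarrow> (nat \<Rightarrow> nat) \<Rightarrow> real mat" where
  "perm_mat m p = mat m m (\<lambda>(a, b). if a = p b then 1 else 0)"

lemma perm_mat_carrier [simp]: "perm_mat m p \<in> carrier_mat m m"
  by (simp add: perm_mat_def)

lemma index_mult_perm_mat:
  assumes "p permutes {..<m}" "A \<in> carrier_mat r m" "i < r" "b < m"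
  shows "(A * perm_mat m p) $$ (i, b) = A $$ (i, p b)"
proof -
  have "p b < m" using permutes_in_image[OF assms(1), of b] assms(4) by simp
  then show ?thesis using assms
    by (simp add: perm_mat_def scalar_prod_def if_distrib sum.delta cong: if_cong)
qed

text \<open>Conjugation by a permutation matrix relabels rows and columns; entries of \<open>N\<^sub>j\<close> are compared in
  this form.\<close>
lemma index_perm_mat_conj:
  assumes "p permutes {..<m}" "A \<in> carrier_mat m m" "a < m" "b < m"
  shows "((perm_mat m p)\<^sup>T * A * perm_mat m p) $$ (a, b) = A $$ (p a, p b)"
proof -
  let ?P = "perm_mat m p"
  have pb: "p b < m" "p a < m" using permutes_in_image[OF assms(1), of b]
    permutes_in_image[OF assms(1), of a] assms(3,4) by auto
  have "(?P\<^sup>T * A * ?P) $$ (a, b) = (?P\<^sup>T * A) $$ (a, p b)"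
    using assms by (intro index_mult_perm_mat) (auto intro: mult_carrier_mat[of _ _ m])
  also have "\<dots> = (A\<^sup>T * ?P)\<^sup>T $$ (a, p b)"
    using transpose_mult[of "A\<^sup>T" m m ?P m] assms(2) by simp
  also have "\<dots> = (A\<^sup>T * ?P) $$ (p b, a)"
    using assms pb by (simp add: perm_mat_def)
  also have "\<dots> = A\<^sup>T $$ (p b, p a)"
    using assms pb by (intro index_mult_perm_mat) auto
  also have "\<dots> = A $$ (p a, p b)" using assms pb by simp
  finally show ?thesis .
qed

lemma perm_mat_orthogonal:
  assumes "p permutes {..<m}"
  shows "(perm_mat m p)\<^sup>T * perm_mat m p = 1\<^sub>m m" "perm_mat m p * (perm_mat m p)\<^sup>T = 1\<^sub>m m"
proof -
  have "(perm_mat m p)\<^sup>T * perm_mat m p = (perm_mat m p)\<^sup>T * 1\<^sub>m m * perm_mat m p"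
    using right_mult_one_mat[of "(perm_mat m p)\<^sup>T" m m] by simp
  also have "\<dots> = 1\<^sub>m m"
  proof (rule eq_matI)
    fix a b assume "a < dim_row (1\<^sub>m m)" "b < dim_col (1\<^sub>m m)"
    then have "a < m" "b < m" by auto
    moreover have "p a < m" "p b < m" using permutes_in_image[OF assms, of b]
      permutes_in_image[OF assms, of a] \<open>a < m\<close> \<open>b < m\<close> by auto
    moreover have "p a = p b \<longleftrightarrow> a = b" using permutes_inj[OF assms] by (auto dest: injD)
    ultimately show "((perm_mat m p)\<^sup>T * 1\<^sub>m m * perm_mat m p) $$ (a, b) = 1\<^sub>m m $$ (a, b)"
      using index_perm_mat_conj[OF assms one_carrier_mat \<open>a < m\<close> \<open>b < m\<close>] by simp
  qed (auto simp: perm_mat_def)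
  finally show "(perm_mat m p)\<^sup>T * perm_mat m p = 1\<^sub>m m" .
  then show "perm_mat m p * (perm_mat m p)\<^sup>T = 1\<^sub>m m"
    by (rule mat_mult_left_right_inverse[rotated 2]) auto
qed

lemma orthogonal_conj_mult:
  fixes P :: "real mat"
  assumes P: "P \<in> carrier_mat m m" "P * P\<^sup>T = 1\<^sub>m m"
    and X: "X \<in> carrier_mat m m" and F: "F \<in> carrier_mat m m"
  shows "(P\<^sup>T * X * P) * (P\<^sup>T * F * P) = P\<^sup>T * (X * F) * P"
proof -
  have Pt: "P\<^sup>T \<in> carrier_mat m m" using P by simp
  note c = mult_carrier_mat[of _ m m _ m] and a = assoc_mult_mat[of _ m m _ m _ m]
  have "(P\<^sup>T * X * P) * (P\<^sup>T * F * P) = P\<^sup>T * (X * ((P * P\<^sup>T) * (F * P)))"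
    using P(1) Pt X F by (simp add: c a del: assoc_mult_mat)
  also have "\<dots> = P\<^sup>T * (X * (F * P))" using F P by (simp add: c)
  also have "\<dots> = P\<^sup>T * (X * F) * P" using P(1) Pt X F by (simp add: c a)
  finally show ?thesis .
qed

text \<open>Where column \<open>b\<close> of \<open>\<Psi>\<^sub>j\<close> stands when \<open>s\<^sub>j\<close> (column \<open>j\<close>) is moved behind the \<open>j\<close> columns
  \<open>y\<^sub>0, \<dots>, y\<^sub>j\<^sub>-\<^sub>1\<close>: these move one place to the left, and \<open>y\<^sub>j\<close> stays last.\<close>
definition pi_perm :: "nat \<Rightarrow> nat \<Rightarrow> nat" where
  "pi_perm j b = (if b = j then 2 * j else if j < b \<and> b \<le> 2 * j then b - 1 else b)"

lemma pi_perm_permutes: "pi_perm j permutes {..<2 * j + 2}"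
proof -
  have "inj (pi_perm j)"
    by (rule injI) (auto simp: pi_perm_def split: if_splits)
  then have "inj_on (pi_perm j) {..<2 * j + 2}" by (auto intro: inj_on_subset)
  moreover have "pi_perm j ` {..<2 * j + 2} \<subseteq> {..<2 * j + 2}" by (auto simp: pi_perm_def)
  ultimately have "bij_betw (pi_perm j) {..<2 * j + 2} {..<2 * j + 2}"
    by (simp add: bij_betw_def endo_inj_surj)
  then show ?thesis by (rule bij_imp_permutes) (simp add: pi_perm_def)
qed

lemma Pi_mat_eq_perm_mat: "Pi_mat j = perm_mat (2 * j + 2) (pi_perm j)"
  by (rule eq_matI) (auto simp: Pi_mat_def perm_mat_def pi_perm_def)

section \<open>Columns and entries by label\<close>

text \<open>The label of a row or column records what it stands for: \<open>Inl i\<close> for \<open>s\<^sub>i\<close>, \<open>Inr i\<close> for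
  \<open>H\<^sub>0 y\<^sub>i\<close>. In terms of labels, the columns of \<open>\<Psi>\<^sub>j\<close> and the entries of \<open>N\<^sub>j\<close> are given by
  functions in which \<open>j\<close> does not occur, and this is what makes \<open>N\<^sub>j\<^sub>-\<^sub>1\<close> a submatrix of
  \<open>N\<^sub>j\<close>.\<close>
definition block_label :: "nat \<Rightarrow> nat \<Rightarrow> nat + nat" where
  "block_label j a = (if a < Suc j then Inl a else Inr (a - Suc j))"

text \<open>The entry of \<open>N\<^sub>j\<close> at a pair of labels, where \<open>\<mu> i\<close> stands for \<open>\<phi> \<lambda>\<^sub>i\<close>. The conditions
  \<open>i \<le> l\<close> come from \<open>R + D\<close>, the part of \<open>S\<^sup>T Y\<close> on and above the diagonal.\<close>
fun middle_entry ::
  "(nat \<Rightarrow> real vec) \<Rightarrow> (nat \<Rightarrow> real vec) \<Rightarrow> real mat \<Rightarrow> (nat \<Rightarrow> real) \<Rightarrow> nat + nat \<Rightarrow> nat + nat \<Rightarrow> real" where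
  "middle_entry s y H \<mu> (Inl i) (Inl l) = (if i = l then - \<mu> i else 0)"
| "middle_entry s y H \<mu> (Inl i) (Inr l) =
    (if i \<le> l then - (s i \<bullet> y l) else 0) - (if i = l then \<mu> i else 0)"
| "middle_entry s y H \<mu> (Inr i) (Inl l) =
    (if l \<le> i then - (s l \<bullet> y i) else 0) - (if i = l then \<mu> i else 0)"
| "middle_entry s y H \<mu> (Inr i) (Inr l) =
    - (y i \<bullet> (H *\<^sub>v y l)) - (if i = l then s i \<bullet> y i + \<mu> i else 0)"

fun Psi_col :: "(nat \<Rightarrow> real vec) \<Rightarrow> (nat \<Rightarrow> real vec) \<Rightarrow> real mat \<Rightarrow> nat + nat \<Rightarrow> real vec" where
  "Psi_col s y H (Inl i) = s i"
| "Psi_col s y H (Inr i) = H *\<^sub>v y i"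

lemma cols_upto_carrier [simp]: "cols_upto n v j \<in> carrier_mat n (Suc j)"
  by (rule carrier_matI) (simp_all only: cols_upto_def mat_of_cols_carrier length_map length_upt diff_zero)

lemma dim_cols_upto [simp]:
  "dim_row (cols_upto n v j) = n" "dim_col (cols_upto n v j) = Suc j"
  by (simp_all only: cols_upto_def mat_of_cols_carrier length_map length_upt diff_zero)

lemma col_cols_upto:
  "i \<le> j \<Longrightarrow> v i \<in> carrier_vec n \<Longrightarrow> col (cols_upto n v j) i = v i"
  unfolding cols_upto_def by (subst col_mat_of_cols) (simp_all del: upt_Suc)

lemma dim_append_cols [simp]:
  "dim_row (append_cols A B) = dim_row A" "dim_col (append_cols A B) = dim_col A + dim_col B"
  by (auto simp: append_cols_def)

lemma col_append_cols:
  assumes "A \<in> carrier_mat n m" "B \<in> carrier_mat n l" "a < m + l"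
  shows "col (append_cols A B) a = (if a < m then col A a else col B (a - m))"
proof -
  have "(cols A @ cols B) ! a = (if a < m then col A a else col B (a - m))"
    using assms by (auto simp: nth_append)
  moreover have "(if a < m then col A a else col B (a - m)) \<in> carrier_vec n"
    using assms by auto
  ultimately show ?thesis using assms unfolding append_cols_def
    by (subst col_mat_of_cols) auto
qed

lemma Psi_mat_carrier [simp]:
  assumes "H \<in> carrier_mat n n"
  shows "Psi_mat n H s y j \<in> carrier_mat n (2 * Suc j)"
  using assms by (intro carrier_matI) (auto simp: Psi_mat_def)

lemma col_Psi_mat:
  assumes "H \<in> carrier_mat n n" "\<And>i. i \<le> j \<Longrightarrow> s i \<in> carrier_vec n"
    "\<And>i. i \<le> j \<Longrightarrow> y i \<in> carrier_vec n" "a < 2 * Suc j"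
  shows "col (Psi_mat n H s y j) a = Psi_col s y H (block_label j a)"
proof -
  have HY: "H * cols_upto n y j \<in> carrier_mat n (Suc j)"
    by (rule mult_carrier_mat[OF assms(1) cols_upto_carrier])
  have col: "col (Psi_mat n H s y j) a = (if a < Suc j then col (cols_upto n s j) a
      else col (H * cols_upto n y j) (a - Suc j))"
    unfolding Psi_mat_def by (rule col_append_cols[OF cols_upto_carrier HY]) (use assms(4) in simp)
  show ?thesis
  proof (cases "a < Suc j")
    case True
    then have "col (cols_upto n s j) a = s a" using assms(2)[of a] by (intro col_cols_upto) auto
    with True show ?thesis by (simp add: col block_label_def)
  next
    case False
    then have a: "a - Suc j < Suc j" using assms(4) by simp
    have "col (H * cols_upto n y j) (a - Suc j) = H *\<^sub>v col (cols_upto n y j) (a - Suc j)"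
      by (rule col_mult2[OF assms(1) cols_upto_carrier a])
    also have "col (cols_upto n y j) (a - Suc j) = y (a - Suc j)"
      using a assms(3)[of "a - Suc j"] by (intro col_cols_upto) auto
    finally show ?thesis using False by (simp add: col block_label_def)
  qed
qed

lemma middle_mat_carrier [simp]:
  "middle_mat n \<phi> B H s y j \<in> carrier_mat (2 * Suc j) (2 * Suc j)"
  unfolding middle_mat_def Let_def Lambda_mat_def mat_diag_def
  by (rule carrier_matI; simp only: index_mat_four_block index_uminus_mat index_smult_mat
      index_minus_mat index_mult_mat index_transpose_mat dim_row_mat dim_col_mat dim_cols_upto; simp)

lemma index_middle_mat:
  assumes H: "H \<in> carrier_mat n n" and s: "\<And>i. i \<le> j \<Longrightarrow> s i \<in> carrier_vec n"
    and y: "\<And>i. i \<le> j \<Longrightarrow> y i \<in> carrier_vec n" and ab: "a < 2 * Suc j" "b < 2 * Suc j"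
  shows "middle_mat n \<phi> B H s y j $$ (a, b) =
    middle_entry s y H (\<lambda>i. \<phi> * lambda_coeff \<phi> (B i) (s i) (y i)) (block_label j a) (block_label j b)"
proof -
  define S where "S = cols_upto n s j"
  define Y where "Y = cols_upto n y j"
  have S: "S \<in> carrier_mat n (Suc j)" and Y: "Y \<in> carrier_mat n (Suc j)"
    by (auto simp: S_def Y_def)
  have SY: "(S\<^sup>T * Y) $$ (i, l) = s i \<bullet> y l" if "i \<le> j" "l \<le> j" for i l
    using that S Y s[of i] y[of l] by (simp add: S_def Y_def col_cols_upto)
  have YHY: "(Y\<^sup>T * H * Y) $$ (i, l) = y i \<bullet> (H *\<^sub>v y l)" if "i \<le> j" "l \<le> j" for i l
  proof -
    have "(Y\<^sup>T * H * Y) $$ (i, l) = (Y\<^sup>T * (H * Y)) $$ (i, l)"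
      using Y H assoc_mult_mat[of "Y\<^sup>T" "Suc j" n H n Y "Suc j"] by simp
    also have "\<dots> = col Y i \<bullet> col (H * Y) l" using that Y H by simp
    also have "\<dots> = y i \<bullet> (H *\<^sub>v y l)" using that y
      by (simp add: col_mult2[OF H Y]) (simp add: Y_def col_cols_upto)
    finally show ?thesis .
  qed
  have dims: "dim_row S = n" "dim_col S = Suc j" "dim_row Y = n" "dim_col Y = Suc j"
    using S Y by auto
  define G where "G = S\<^sup>T * Y"
  define W where "W = Y\<^sup>T * H * Y"
  have G: "dim_row G = Suc j" "dim_col G = Suc j" "dim_row W = Suc j" "dim_col W = Suc j"
    using dims by (auto simp: G_def W_def)
  show ?thesis using ab
    unfolding middle_mat_def Let_def S_def[symmetric] Y_def[symmetric] G_def[symmetric] W_def[symmetric]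
    by (auto simp: G block_label_def diag_part_def strict_upper_part_def
        Lambda_mat_def mat_diag_def SY[folded G_def] YHY[folded W_def])
qed

lemma middle_entry_commute:
  assumes "\<And>i. i \<le> j \<Longrightarrow> y i \<in> carrier_vec n" "H \<in> carrier_mat n n" "H\<^sup>T = H"
    "a < 2 * Suc j" "b < 2 * Suc j"
  shows "middle_entry s y H \<mu> (block_label j a) (block_label j b) =
    middle_entry s y H \<mu> (block_label j b) (block_label j a)"
proof -
  have "y i \<bullet> (H *\<^sub>v y l) = y l \<bullet> (H *\<^sub>v y i)" if "i \<le> j" "l \<le> j" for i l
    using assms that scalar_prod_mult_mat_vec[OF assms(2), of "y i" "y l"]
      comm_scalar_prod[of "y l" n "H *\<^sub>v y i"] by simp
  then show ?thesis using assms(4,5) by (auto simp: block_label_def)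
qed

lemma middle_mat_symmetric:
  assumes H: "H \<in> carrier_mat n n" "H\<^sup>T = H" and s: "\<And>i. i \<le> j \<Longrightarrow> s i \<in> carrier_vec n"
    and y: "\<And>i. i \<le> j \<Longrightarrow> y i \<in> carrier_vec n"
  shows "(middle_mat n \<phi> B H s y j)\<^sup>T = middle_mat n \<phi> B H s y j"
proof (rule eq_matI)
  let ?N = "middle_mat n \<phi> B H s y j"
  let ?e = "middle_entry s y H (\<lambda>i. \<phi> * lambda_coeff \<phi> (B i) (s i) (y i))"
  note N = middle_mat_carrier[of n \<phi> B H s y j]
  fix a b assume "a < dim_row ?N" "b < dim_col ?N"
  then have ab: "a < 2 * Suc j" "b < 2 * Suc j" using N by auto
  then have "?N\<^sup>T $$ (a, b) = ?N $$ (b, a)" using N by auto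
  also have "\<dots> = ?e (block_label j b) (block_label j a)"
    by (rule index_middle_mat[OF H(1) s y ab(2,1)])
  also have "\<dots> = ?e (block_label j a) (block_label j b)"
    by (rule middle_entry_commute[OF y H ab(2,1)])
  also have "\<dots> = ?N $$ (a, b)" by (rule index_middle_mat[OF H(1) s y ab, symmetric])
  finally show "?N\<^sup>T $$ (a, b) = ?N $$ (a, b)" .
qed (use middle_mat_carrier[of n \<phi> B H s y j] in auto)

section \<open>Moving the new pair to the end\<close>

text \<open>The labels in the order of the bordered matrix: those of \<open>\<Psi>\<^sub>j\<close> first, followed by the new
  pair.\<close>
definition bordered_label :: "nat \<Rightarrow> nat \<Rightarrow> nat + nat" where
  "bordered_label j c = (if c < 2 * Suc j then block_label j c
    else if c = 2 * Suc j then Inl (Suc j) else Inr (Suc j))"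

lemma block_label_eq_bordered_label:
  assumes "b < 2 * Suc (Suc j)"
  shows "block_label (Suc j) b = bordered_label j (pi_perm (Suc j) b)"
  using assms by (auto simp: block_label_def bordered_label_def pi_perm_def)

lemma Psi_mat_permute:
  assumes H: "H \<in> carrier_mat n n" and s: "\<And>i. i \<le> Suc j \<Longrightarrow> s i \<in> carrier_vec n"
    and y: "\<And>i. i \<le> Suc j \<Longrightarrow> y i \<in> carrier_vec n"
  shows "append_cols (Psi_mat n H s y j) (mat_of_cols n [s (Suc j), H *\<^sub>v y (Suc j)]) * Pi_mat (Suc j)
    = Psi_mat n H s y (Suc j)"
proof -
  let ?m = "2 * Suc j"
  let ?C = "mat_of_cols n [s (Suc j), H *\<^sub>v y (Suc j)]"
  let ?A = "append_cols (Psi_mat n H s y j) ?C"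
  have Psi: "Psi_mat n H s y i \<in> carrier_mat n (2 * Suc i)" for i using H by (rule Psi_mat_carrier)
  have C: "?C \<in> carrier_mat n 2" by (rule carrier_matI) simp_all
  have A: "?A \<in> carrier_mat n (?m + 2)" using Psi[of j] C by (intro carrier_matI) auto
  have colA: "col ?A c = Psi_col s y H (bordered_label j c)" if c: "c < ?m + 2" for c
  proof (cases "c < ?m")
    case True
    have "col (Psi_mat n H s y j) c = Psi_col s y H (block_label j c)"
      using True s y by (intro col_Psi_mat[OF H]) auto
    then show ?thesis using True c by (simp add: col_append_cols[OF Psi C] bordered_label_def)
  next
    case False
    have "col ?A c = col ?C (c - ?m)" using False c by (simp add: col_append_cols[OF Psi C])
    moreover have "H *\<^sub>v y (Suc j) \<in> carrier_vec n" using H y[of "Suc j"] by simp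
    moreover have "c = ?m \<or> c = Suc ?m" using c False by auto
    ultimately show ?thesis using s[of "Suc j"] by (auto simp: bordered_label_def)
  qed
  show ?thesis
  proof (rule eq_matI)
    fix r b assume "r < dim_row (Psi_mat n H s y (Suc j))" "b < dim_col (Psi_mat n H s y (Suc j))"
    then have r: "r < n" and b: "b < 2 * Suc (Suc j)" using Psi[of "Suc j"] by auto
    have pb: "pi_perm (Suc j) b < ?m + 2" using b by (auto simp: pi_perm_def)
    have "(?A * Pi_mat (Suc j)) $$ (r, b) = ?A $$ (r, pi_perm (Suc j) b)"
      using A r b pi_perm_permutes[of "Suc j"] unfolding Pi_mat_eq_perm_mat
      by (intro index_mult_perm_mat) auto
    also have "\<dots> = col ?A (pi_perm (Suc j) b) $ r"
      using carrier_matD[OF Psi[of j]] r pb by simp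
    also have "\<dots> = col (Psi_mat n H s y (Suc j)) b $ r"
      by (simp add: colA[OF pb] col_Psi_mat[OF H s y b] block_label_eq_bordered_label[OF b])
    also have "\<dots> = Psi_mat n H s y (Suc j) $$ (r, b)" using Psi[of "Suc j"] r b by simp
    finally show "(?A * Pi_mat (Suc j)) $$ (r, b) = Psi_mat n H s y (Suc j) $$ (r, b)" .
  qed (use A Psi[of "Suc j"] in \<open>auto simp: Pi_mat_eq_perm_mat perm_mat_def\<close>)
qed

text \<open>Moving the new pair to the end exhibits \<open>N\<^sub>j\<^sub>+\<^sub>1\<close> as \<open>N\<^sub>j\<close> with a border. The border vector of
  \<open>s\<^sub>j\<^sub>+\<^sub>1\<close> is zero because \<open>R\<close> and \<open>D\<close> contain no product \<open>s\<^sub>j\<^sub>+\<^sub>1 \<bullet> y\<^sub>i\<close> with \<open>i \<le> j\<close>, and that of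
  \<open>y\<^sub>j\<^sub>+\<^sub>1\<close> collects the products \<open>s\<^sub>i \<bullet> y\<^sub>j\<^sub>+\<^sub>1\<close> and \<open>y\<^sub>i \<bullet> H\<^sub>0 y\<^sub>j\<^sub>+\<^sub>1\<close>, which by symmetry of \<open>H\<^sub>0\<close> are the
  components of \<open>\<Psi>\<^sub>j\<^sup>T y\<^sub>j\<^sub>+\<^sub>1\<close>.\<close>
lemma middle_mat_permute:
  fixes \<phi> :: real and B :: "nat \<Rightarrow> real mat"
  assumes H: "H \<in> carrier_mat n n" "H\<^sup>T = H" and s: "\<And>i. i \<le> Suc j \<Longrightarrow> s i \<in> carrier_vec n"
    and y: "\<And>i. i \<le> Suc j \<Longrightarrow> y i \<in> carrier_vec n"
  defines "m \<equiv> 2 * Suc j"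
  defines "p \<equiv> (Psi_mat n H s y j)\<^sup>T *\<^sub>v y (Suc j)"
  defines "\<mu> \<equiv> \<phi> * lambda_coeff \<phi> (B (Suc j)) (s (Suc j)) (y (Suc j))"
  defines "\<sigma> \<equiv> s (Suc j) \<bullet> y (Suc j)"
  shows "middle_mat n \<phi> B H s y (Suc j) = (Pi_mat (Suc j))\<^sup>T *
    four_block_mat (middle_mat n \<phi> B H s y j)
      (mat_of_cols m [0\<^sub>v m, - p]) (mat_of_rows m [0\<^sub>v m, - p])
      (mat_of_rows_list 2 [[- \<mu>, - \<sigma> - \<mu>], [- \<sigma> - \<mu>, - \<sigma> - \<mu> - y (Suc j) \<bullet> (H *\<^sub>v y (Suc j))]])
    * Pi_mat (Suc j)" (is "?N = ?P\<^sup>T * ?F * ?P")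
proof -
  let ?e = "middle_entry s y H (\<lambda>i. \<phi> * lambda_coeff \<phi> (B i) (s i) (y i))"
  have N: "middle_mat n \<phi> B H s y j \<in> carrier_mat m m" unfolding m_def by (rule middle_mat_carrier)
  have N': "?N \<in> carrier_mat (m + 2) (m + 2)"
    using middle_mat_carrier[of n \<phi> B H s y "Suc j"] by (simp add: m_def)
  have Psi: "Psi_mat n H s y j \<in> carrier_mat n m" unfolding m_def using H(1) by (rule Psi_mat_carrier)
  have p: "p \<in> carrier_vec m" using Psi y by (simp add: p_def)
  have F: "?F \<in> carrier_mat (m + 2) (m + 2)"
    using N by (intro carrier_matI) (auto simp: mat_of_rows_list_def)
  have p_entry: "?e (block_label j c) (Inr (Suc j)) = - (p $ c)"
    "?e (Inr (Suc j)) (block_label j c) = - (p $ c)"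
    "?e (block_label j c) (Inl (Suc j)) = 0" "?e (Inl (Suc j)) (block_label j c) = 0"
    if c: "c < m" for c
  proof -
    have "p $ c = Psi_col s y H (block_label j c) \<bullet> y (Suc j)"
      using c Psi s y col_Psi_mat[OF H(1), of j s y c] by (simp add: p_def m_def)
    moreover have "(H *\<^sub>v y i) \<bullet> y (Suc j) = y i \<bullet> (H *\<^sub>v y (Suc j))"
      "y (Suc j) \<bullet> (H *\<^sub>v y i) = y i \<bullet> (H *\<^sub>v y (Suc j))" if "i \<le> j" for i
    proof -
      have yi: "y i \<in> carrier_vec n" "y (Suc j) \<in> carrier_vec n" using y that by auto
      show "(H *\<^sub>v y i) \<bullet> y (Suc j) = y i \<bullet> (H *\<^sub>v y (Suc j))"
        using scalar_prod_mult_mat_vec[OF H(1) yi] H(2) by simp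
      then show "y (Suc j) \<bullet> (H *\<^sub>v y i) = y i \<bullet> (H *\<^sub>v y (Suc j))"
        using comm_scalar_prod[of "H *\<^sub>v y i" n "y (Suc j)"] H(1) yi by simp
    qed
    ultimately show "?e (block_label j c) (Inr (Suc j)) = - (p $ c)"
      "?e (Inr (Suc j)) (block_label j c) = - (p $ c)"
      "?e (block_label j c) (Inl (Suc j)) = 0" "?e (Inl (Suc j)) (block_label j c) = 0"
      using c by (auto simp: block_label_def m_def)
  qed
  have F_entry: "?F $$ (c, d) = ?e (bordered_label j c) (bordered_label j d)"
    if c: "c < m + 2" and d: "d < m + 2" for c d
  proof -
    have old: "middle_mat n \<phi> B H s y j $$ (c, d) = ?e (block_label j c) (block_label j d)"
      if "c < m" "d < m"
      using that s y unfolding m_def by (intro index_middle_mat[OF H(1)]) auto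
    have "c < m \<or> c = m \<or> c = Suc m" "d < m \<or> d = m \<or> d = Suc m" using c d by auto
    moreover have "bordered_label j c = (if c < m then block_label j c
        else if c = m then Inl (Suc j) else Inr (Suc j))" for c
      by (simp only: bordered_label_def m_def)
    ultimately show ?thesis using N p
      by (elim disjE) (simp_all add: old p_entry
          mat_of_cols_index mat_of_rows_index mat_of_rows_list_def \<sigma>_def \<mu>_def)
  qed
  have perm: "pi_perm (Suc j) permutes {..<m + 2}"
    using pi_perm_permutes[of "Suc j"] by (simp add: m_def)
  have P: "?P = perm_mat (m + 2) (pi_perm (Suc j))" by (simp add: Pi_mat_eq_perm_mat m_def)
  show ?thesis
  proof (rule eq_matI)
    fix a b assume "a < dim_row (?P\<^sup>T * ?F * ?P)" "b < dim_col (?P\<^sup>T * ?F * ?P)"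
    then have a: "a < m + 2" and b: "b < m + 2" by (auto simp: P perm_mat_def)
    then have pab: "pi_perm (Suc j) a < m + 2" "pi_perm (Suc j) b < m + 2"
      by (auto simp: pi_perm_def m_def)
    have ab: "a < 2 * Suc (Suc j)" "b < 2 * Suc (Suc j)" using a b by (auto simp: m_def)
    have "(?P\<^sup>T * ?F * ?P) $$ (a, b) = ?F $$ (pi_perm (Suc j) a, pi_perm (Suc j) b)"
      unfolding P by (rule index_perm_mat_conj[OF perm F a b])
    also have "\<dots> = ?e (block_label (Suc j) a) (block_label (Suc j) b)"
      by (simp only: F_entry[OF pab] block_label_eq_bordered_label[OF ab(1)]
          block_label_eq_bordered_label[OF ab(2)])
    also have "\<dots> = ?N $$ (a, b)" by (rule index_middle_mat[OF H(1) s y ab, symmetric])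
    finally show "?N $$ (a, b) = (?P\<^sup>T * ?F * ?P) $$ (a, b)" by simp
  qed (use N' in \<open>auto simp: P perm_mat_def\<close>)
qed

section \<open>The recursion\<close>

theorem theorem1:
  fixes n k :: nat and \<phi> :: real
    and s y :: "nat \<Rightarrow> real vec"
    and B H M \<Psi> :: "nat \<Rightarrow> real mat"
    and \<alpha> \<beta> \<delta> :: "nat \<Rightarrow> real"
  assumes phi: "0 \<le> \<phi>" "\<phi> \<le> 1"
    and s_dim: "\<And>i. i \<le> k \<Longrightarrow> s i \<in> carrier_vec n"
    and y_dim: "\<And>i. i \<le> k \<Longrightarrow> y i \<in> carrier_vec n"
    and updates: "\<And>i. i \<le> k \<Longrightarrow> B (Suc i) = broyden_update \<phi> (B i) (s i) (y i)"
    and s_nonzero: "\<And>i. i \<le> k \<Longrightarrow> s i \<noteq> 0\<^sub>v n"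
    and ys_nonzero: "\<And>i. i \<le> k \<Longrightarrow> y i \<bullet> s i \<noteq> 0"
    and B_pos_def: "\<And>i. i \<le> Suc k \<Longrightarrow> sym_pos_def n (B i)"
    and H_inverse: "\<And>i. i \<le> Suc k \<Longrightarrow> is_inverse_mat (B i) (H i)"
    and Psi: "\<And>j. j \<le> k \<Longrightarrow> \<Psi> j = Psi_mat n (H 0) s y j"
    and M_inverse: "\<And>j. j \<le> k \<Longrightarrow> is_inverse_mat (middle_mat n \<phi> B (H 0) s y j) (M j)"
    and compact: "\<And>j. j \<le> k \<Longrightarrow> H (Suc j) = H 0 + \<Psi> j * M j * (\<Psi> j)\<^sup>T"
    and alpha: "\<And>j. j \<le> k \<Longrightarrow> \<alpha> j = alpha_coeff \<phi> (B j) (H j) (s j) (y j)"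
    and beta: "\<And>j. j \<le> k \<Longrightarrow> \<beta> j = beta_coeff \<phi> (B j) (H j) (s j) (y j)"
    and delta: "\<And>j. j \<le> k \<Longrightarrow> \<delta> j = delta_coeff \<phi> (B j) (H j) (s j) (y j)"
    and M_0: "M 0 = mat_of_rows_list 2 [[\<alpha> 0, \<beta> 0], [\<beta> 0, \<delta> 0]]"
  shows "\<forall>j \<in> {1..k}.
    (let u = M (j - 1) *\<^sub>v ((\<Psi> (j - 1))\<^sup>T *\<^sub>v y j) in
       M j = (Pi_mat j)\<^sup>T * bordered_mat (M (j - 1)) u (\<alpha> j) (\<beta> j) (\<delta> j) * Pi_mat j) \<and>
    is_permutation_mat (2 * j + 2) (Pi_mat j) \<and>
    append_cols (\<Psi> (j - 1)) (mat_of_cols n [s j, H 0 *\<^sub>v y j]) * Pi_mat j = \<Psi> j"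
proof (intro ballI conjI)
  fix j assume "j \<in> {1..k}"
  then obtain i where j: "j = Suc i" and ik: "Suc i \<le> k" by (cases j) auto
  have B: "B l \<in> carrier_mat n n" if "l \<le> Suc k" for l
    using B_pos_def[OF that] by (simp add: sym_pos_def_def)
  have H: "H l \<in> carrier_mat n n" if "l \<le> Suc k" for l
    using is_inverse_mat_carrier[OF H_inverse[OF that] B[OF that]] by simp
  have H0: "H 0 \<in> carrier_mat n n" "(H 0)\<^sup>T = H 0"
    using H transpose_inverse_symmetric[OF H_inverse B] B_pos_def[of 0] by (auto simp: sym_pos_def_def)
  have sy: "\<And>l. l \<le> Suc i \<Longrightarrow> s l \<in> carrier_vec n" "\<And>l. l \<le> Suc i \<Longrightarrow> y l \<in> carrier_vec n"
    using s_dim y_dim ik by auto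
  have sj: "s j \<in> carrier_vec n" and yj: "y j \<in> carrier_vec n" using sy j by auto
  have Psi_j: "\<Psi> (j - 1) = Psi_mat n (H 0) s y i" "\<Psi> j = Psi_mat n (H 0) s y (Suc i)"
    using Psi[of i] Psi[of j] ik j by auto

  show "append_cols (\<Psi> (j - 1)) (mat_of_cols n [s j, H 0 *\<^sub>v y j]) * Pi_mat j = \<Psi> j"
    unfolding Psi_j unfolding j by (rule Psi_mat_permute[OF H0(1) sy])

  show "is_permutation_mat (2 * j + 2) (Pi_mat j)"
    unfolding is_permutation_mat_def Pi_mat_eq_perm_mat perm_mat_def using pi_perm_permutes by blast

  define m where "m = 2 * Suc i"
  define N where "N = middle_mat n \<phi> B (H 0) s y i"
  define p where "p = (\<Psi> i)\<^sup>T *\<^sub>v y j"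
  define u where "u = M i *\<^sub>v p"
  have Psi_i: "\<Psi> i \<in> carrier_mat n m"
    using Psi[of i] ik Psi_mat_carrier[OF H0(1), of s y i] by (simp add: m_def)
  have N: "N \<in> carrier_mat m m" unfolding N_def m_def by (rule middle_mat_carrier)
  have Nsym: "N\<^sup>T = N" unfolding N_def using sy by (intro middle_mat_symmetric[OF H0]) auto
  have Mi: "M i \<in> carrier_mat m m" "N * M i = 1\<^sub>m m" "M i * N = 1\<^sub>m m"
    using is_inverse_mat_carrier[OF M_inverse[of i, folded N_def] N] ik by auto
  have p: "p \<in> carrier_vec m" using Psi_i yj by (simp add: p_def)
  have u: "u \<in> carrier_vec m" using Mi p by (simp add: u_def)

  define \<sigma> where "\<sigma> = s j \<bullet> y j"
  define \<tau> where "\<tau> = s j \<bullet> (B j *\<^sub>v s j)"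
  define \<eta> where "\<eta> = y j \<bullet> (H j *\<^sub>v y j)"
  define \<mu> where "\<mu> = \<phi> * lambda_coeff \<phi> (B j) (s j) (y j)"
  have jk: "j \<le> k" using ik j by simp
  have \<sigma>': "y j \<bullet> s j = \<sigma>" using comm_scalar_prod[OF yj sj] by (simp add: \<sigma>_def)
  have \<tau>: "\<tau> > 0" using B_pos_def[of j] jk sj s_nonzero[OF jk] by (auto simp: sym_pos_def_def \<tau>_def)
  have "B (Suc j) *\<^sub>v s j = y j"
    using updates[OF jk] broyden_update_secant[OF B sj yj, of j \<phi>] \<tau> ys_nonzero[OF jk] jk
    by (simp add: \<tau>_def)
  \<comment> \<open>By the secant equation, \<open>\<sigma>\<close> is a value of the quadratic form of \<open>B (Suc j)\<close>.\<close>
  then have \<sigma>: "\<sigma> > 0"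
    using B_pos_def[of "Suc j"] jk sj s_nonzero[OF jk] by (auto simp: sym_pos_def_def \<sigma>_def)
  have "y j \<noteq> 0\<^sub>v n" using ys_nonzero[OF jk] sj by auto
  then have \<eta>: "\<eta> > 0"
    unfolding \<eta>_def using jk yj by (intro sym_pos_def_inverse_quadratic_form_pos[OF B_pos_def H_inverse]) auto
  \<comment> \<open>The compact representation of \<open>H j\<close>, evaluated at \<open>y j\<close>.\<close>
  have \<eta>_eq: "\<eta> = y j \<bullet> (H 0 *\<^sub>v y j) + p \<bullet> u"
  proof -
    have T: "(\<Psi> i)\<^sup>T \<in> carrier_mat m n" using Psi_i by simp
    have PM: "\<Psi> i * M i \<in> carrier_mat n m" using Psi_i Mi by auto
    have "\<Psi> i * M i * (\<Psi> i)\<^sup>T *\<^sub>v y j = \<Psi> i *\<^sub>v u"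
      using assoc_mult_mat_vec[OF PM T yj] assoc_mult_mat_vec[OF Psi_i Mi(1) p]
      by (simp add: p_def u_def)
    then have "H j *\<^sub>v y j = H 0 *\<^sub>v y j + \<Psi> i *\<^sub>v u"
      using compact[of i] ik add_mult_distrib_mat_vec[OF H0(1) mult_carrier_mat[OF PM T] yj] by (simp add: j)
    moreover have "y j \<bullet> (\<Psi> i *\<^sub>v u) = p \<bullet> u"
      unfolding p_def by (rule scalar_prod_mult_mat_vec[OF Psi_i yj u])
    moreover have "H 0 *\<^sub>v y j \<in> carrier_vec n" "\<Psi> i *\<^sub>v u \<in> carrier_vec n" using H0 yj Psi_i u by auto
    ultimately show ?thesis unfolding \<eta>_def using scalar_prod_add_distrib[OF yj] by simp
  qed

  define a where "a = - \<mu>"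
  define b where "b = - \<sigma> - \<mu>"
  define c where "c = - \<sigma> - \<mu> - y j \<bullet> (H 0 *\<^sub>v y j)"
  \<comment> \<open>The Schur complement involves \<open>H j\<close> in place of \<open>H 0\<close>.\<close>
  have "c - p \<bullet> u = - \<sigma> - \<mu> - \<eta>" by (simp add: c_def \<eta>_eq)
  moreover have "\<mu> = \<phi> * (1 / (- ((1 - \<phi>) / \<tau>) - \<phi> / \<sigma>))"
    by (simp add: \<mu>_def lambda_coeff_def \<sigma>_def \<tau>_def)
  moreover have "Phi_coeff \<phi> (B j) (H j) (s j) (y j)
      = (1 - \<phi>) * \<sigma>\<^sup>2 / ((1 - \<phi>) * \<sigma>\<^sup>2 + \<phi> * \<eta> * \<tau>)"
    by (simp add: Phi_coeff_def \<sigma>' \<eta>_def \<tau>_def)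
  ultimately have corner: "\<alpha> j * a + \<beta> j * b = 1" "\<alpha> j * b + \<beta> j * (c - p \<bullet> u) = 0"
      "\<beta> j * a + \<delta> j * b = 0" "\<beta> j * b + \<delta> j * (c - p \<bullet> u) = 1"
    using corner_inverse[OF phi \<sigma> \<tau> \<eta>] alpha[OF jk] beta[OF jk] delta[OF jk]
    by (simp_all only: alpha_coeff_def beta_coeff_def delta_coeff_def \<sigma>' \<sigma>_def[symmetric]
        \<eta>_def[symmetric] a_def b_def)

  define X where "X = bordered_mat (M i) u (\<alpha> j) (\<beta> j) (\<delta> j)"
  define F where "F = four_block_mat N (mat_of_cols m [0\<^sub>v m, - p]) (mat_of_rows m [0\<^sub>v m, - p])
      (mat_of_rows_list 2 [[a, b], [b, c]])"
  have XF: "X * F = 1\<^sub>m (m + 2)"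
    unfolding X_def F_def u_def
    by (rule four_block_inverse_bordered[OF N Nsym Mi(1,3,2) p corner[unfolded u_def]])
  have X: "X \<in> carrier_mat (m + 2) (m + 2)" and F: "F \<in> carrier_mat (m + 2) (m + 2)"
    using u N by (auto simp: X_def F_def bordered_mat_def mat_of_rows_list_def intro!: carrier_matI)
  let ?P = "Pi_mat j"
  have m2: "2 * j + 2 = m + 2" by (simp add: j m_def)
  have P: "?P = perm_mat (m + 2) (pi_perm j)" "pi_perm j permutes {..<m + 2}"
    using Pi_mat_eq_perm_mat[of j] pi_perm_permutes[of j] unfolding m2 by auto
  have Pc: "?P \<in> carrier_mat (m + 2) (m + 2)" and Pt: "?P\<^sup>T * ?P = 1\<^sub>m (m + 2)" "?P * ?P\<^sup>T = 1\<^sub>m (m + 2)"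
    using perm_mat_orthogonal[OF P(2)] by (auto simp: P(1))
  have NF: "middle_mat n \<phi> B (H 0) s y j = ?P\<^sup>T * F * ?P"
    using middle_mat_permute[OF H0 sy, where \<phi> = \<phi> and B = B] Psi[of i] ik
    by (simp add: F_def N_def m_def p_def \<mu>_def \<sigma>_def a_def b_def c_def j)
  have Nc: "middle_mat n \<phi> B (H 0) s y j \<in> carrier_mat (m + 2) (m + 2)"
    using middle_mat_carrier[of n \<phi> B "H 0" s y j] by (simp add: j m_def)
  have "(?P\<^sup>T * X * ?P) * middle_mat n \<phi> B (H 0) s y j = ?P\<^sup>T * (X * F) * ?P"
    unfolding NF by (rule orthogonal_conj_mult[OF Pc Pt(2) X F])
  also have "\<dots> = 1\<^sub>m (m + 2)" using Pc Pt(1) by (simp add: XF)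
  finally have left: "(?P\<^sup>T * X * ?P) * middle_mat n \<phi> B (H 0) s y j = 1\<^sub>m (m + 2)" .
  note Mj = is_inverse_mat_carrier[OF M_inverse[OF jk] Nc]
  have PXP: "?P\<^sup>T * X * ?P \<in> carrier_mat (m + 2) (m + 2)" using Pc X by auto
  have "M j = (?P\<^sup>T * X * ?P) * middle_mat n \<phi> B (H 0) s y j * M j" using left Mj(1) by simp
  also have "\<dots> = (?P\<^sup>T * X * ?P) * (middle_mat n \<phi> B (H 0) s y j * M j)"
    by (rule assoc_mult_mat[OF PXP Nc Mj(1)])
  also have "\<dots> = ?P\<^sup>T * X * ?P" unfolding Mj(2) by (rule right_mult_one_mat[OF PXP])
  finally show "let u = M (j - 1) *\<^sub>v ((\<Psi> (j - 1))\<^sup>T *\<^sub>v y j) in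
      M j = (Pi_mat j)\<^sup>T * bordered_mat (M (j - 1)) u (\<alpha> j) (\<beta> j) (\<delta> j) * Pi_mat j"
    by (simp add: Let_def X_def u_def p_def j)
qed

end
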